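(* For all $n\in\mathbb{N}$ and all $\pi=\pi_1\pi_2\cdots\pi_n\in S_n$, \[\operatorname{sc}(\pi)=\max_{i\in[n]}\operatorname{sc}(\pi^i),\] where $\pi^i$ is the sequence obtained from $\pi_1\pi_2\cdots\pi_i$ by deleting every entry less than $\pi_i$ (equivalently, the subsequence of $\pi_1\cdots\pi_i$ consisting of entries $\ge \pi_i$).
   Context: A "permutation" here may be any finite sequence of distinct integers. West's stack-sorting map $s$ acts on such a sequence as follows: read the input from left to right with an initially empty stack; repeatedly, if the input is nonempty and either the stack is empty or the top element of the stack is greater than the next input entry, push the next input entry onto the stack; otherwise pop the top element of the stack and append it to the output; stop when both input and stack are empty. The output is $s(\pi)$. For a sequence $\pi$, $\operatorname{sc}(\pi)$ denotes the least integer $k\ge0$ such that $s^k(\pi)$ is increasing. $S_n$ is the set of permutations of $[n]=\{1,\dots,n\}$, written in one-line notation. *)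

theory Defs
  imports "HOL-Combinatorics.Multiset_Permutations"
begin

text \<open>
  \<open>stack_run xs st\<close> is the output still to be produced when the remaining input is \<open>xs\<close> and the
  stack contents are \<open>st\<close>, with the top of the stack at the head of the list.
\<close>
function stack_run :: "int list \<Rightarrow> int list \<Rightarrow> int list" where
  "stack_run [] [] = []"
| "stack_run (x # xs) [] = stack_run xs [x]"
| "stack_run (x # xs) (t # st) =
     (if t > x then stack_run xs (x # t # st) else t # stack_run (x # xs) st)"
| "stack_run [] (t # st) = t # stack_run [] st"
  by pat_completeness auto
termination
  by (relation "measure (\<lambda>(xs, st). 2 * length xs + length st)") auto

definition stack_sort :: "int list \<Rightarrow> int list" where
  "stack_sort xs = stack_run xs []"

definition sc :: "int list \<Rightarrow> nat" where
  "sc xs = (LEAST k. sorted_wrt (<) ((stack_sort ^^ k) xs))"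

text \<open>The index \<open>i\<close> is 1-based: \<open>xs ! (i - 1)\<close> is the \<open>i\<close>-th entry.\<close>
definition prefix_ge :: "int list \<Rightarrow> nat \<Rightarrow> int list" where
  "prefix_ge xs i = filter (\<lambda>x. \<not> x < xs ! (i - 1)) (take i xs)"

end

theory Submission
  imports Defs
begin

text \<open>
  For an entry \<open>a\<close> of a sequence, look at the word \<open>A\<close> of the entries greater than \<open>a\<close> that
  precede \<open>a\<close>. When \<open>a\<close> is pushed, no entry greater than \<open>a\<close> is popped, and \<open>a\<close> itself leaves the
  stack before any of those that are still there. Entries smaller than \<open>a\<close> never cause one of the
  greater entries to be popped. Hence after one pass the corresponding word is the one popped while
  \<open>A\<close> alone is read: it depends on \<open>A\<close> only. A sequence of distinct entries is increasing iff all
  these words are empty, so the number of passes needed is determined by the words of its entries.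
  The entries of \<open>\<pi>\<^sup>i\<close> have the same words in \<open>\<pi>\<^sup>i\<close> as in \<open>\<pi>\<close>, and every entry of
  \<open>\<pi>\<close> occurs in some \<open>\<pi>\<^sup>i\<close>.
\<close>

definition greater_before :: "'a::linorder \<Rightarrow> 'a list \<Rightarrow> 'a list" where
  "greater_before a xs = filter (\<lambda>x. a < x) (takeWhile (\<lambda>x. x \<noteq> a) xs)"

lemma greater_before_Nil [simp]: "greater_before a [] = []"
  by (simp add: greater_before_def)

lemma greater_before_Cons [simp]:
  "greater_before a (x # xs) =
     (if x = a then [] else if a < x then x # greater_before a xs else greater_before a xs)"
  by (cases "x = a") (simp_all add: greater_before_def)

lemma length_greater_before_le: "length (greater_before a xs) \<le> length xs"
  by (induction xs) auto

lemma greater_before_append1: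
  "a \<in> set xs \<Longrightarrow> greater_before a (xs @ ys) = greater_before a xs"
  by (simp add: greater_before_def)

lemma greater_before_filter:
  assumes "\<And>x. a \<le> x \<Longrightarrow> P x"
  shows "greater_before a (filter P xs) = greater_before a xs"
  using assms by (induction xs) auto

lemma sorted_wrt_less_iff_greater_before:
  assumes "distinct xs"
  shows "sorted_wrt (<) xs \<longleftrightarrow> (\<forall>a\<in>set xs. greater_before a xs = [])"
  using assms
proof (induction xs)
  case (Cons x xs)
  have "greater_before a (x # xs) = [] \<longleftrightarrow> x < a \<and> greater_before a xs = []"
    if "a \<in> set xs" for a
    using that Cons.prems by auto
  with Cons show ?case by auto
qed simp

text \<open>Unlike \<open>stack_run\<close>, the stack is not emptied once the input is exhausted.\<close>
function popped_run :: "'a::linorder list \<Rightarrow> 'a list \<Rightarrow> 'a list" where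
  "popped_run [] st = []"
| "popped_run (x # xs) [] = popped_run xs [x]"
| "popped_run (x # xs) (t # st) =
     (if t > x then popped_run xs (x # t # st) else t # popped_run (x # xs) st)"
  by pat_completeness auto
termination
  by (relation "measure (\<lambda>(xs, st). 2 * length xs + length st)") auto

definition popped :: "'a::linorder list \<Rightarrow> 'a list" where
  "popped xs = popped_run xs []"

lemma length_popped_run_less:
  "xs \<noteq> [] \<or> st \<noteq> [] \<Longrightarrow> length (popped_run xs st) < length xs + length st"
  by (induction xs st rule: popped_run.induct) auto

lemma length_popped_le: "length (popped xs) \<le> length xs - 1"
  using length_popped_run_less[of xs "[]"] by (cases xs) (auto simp: popped_def)

lemma popped_funpow_eq_Nil: "length xs \<le> k \<Longrightarrow> (popped ^^ k) xs = []"
proof (induction k arbitrary: xs)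
  case (Suc k)
  then have "length (popped xs) \<le> k"
    using length_popped_le[of xs] by linarith
  then have "(popped ^^ k) (popped xs) = []"
    by (rule Suc.IH)
  then show ?case
    by (simp only: funpow_Suc_right o_apply)
qed simp

lemma popped_funpow_eq_Nil_mono:
  assumes "(popped ^^ i) xs = []" and "i \<le> j"
  shows "(popped ^^ j) xs = []"
proof -
  obtain d where "j = d + i"
    using assms(2) by (metis le_add_diff_inverse2)
  then show ?thesis
    by (simp add: funpow_add assms(1) popped_funpow_eq_Nil)
qed

lemma mset_stack_run: "mset (stack_run xs st) = mset xs + mset st"
  by (induction xs st rule: stack_run.induct) auto

lemma mset_stack_sort_funpow: "mset ((stack_sort ^^ k) xs) = mset xs"
  by (induction k) (auto simp: stack_sort_def mset_stack_run)

lemma set_stack_sort_funpow: "set ((stack_sort ^^ k) xs) = set xs"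
  by (rule mset_eq_setD[OF mset_stack_sort_funpow])

lemma distinct_stack_sort_funpow: "distinct ((stack_sort ^^ k) xs) \<longleftrightarrow> distinct xs"
  by (rule mset_eq_imp_distinct_iff[OF mset_stack_sort_funpow])

lemma greater_before_stack_run_stacked:
  "a \<in> set st \<Longrightarrow> greater_before a st = [] \<Longrightarrow> greater_before a (stack_run xs st) = []"
  by (induction xs st rule: stack_run.induct) (auto split: if_splits)

lemma greater_before_stack_run:
  assumes "a \<in> set xs" "a \<notin> set st"
  shows "greater_before a (stack_run xs st) =
           popped_run (greater_before a xs) (filter (\<lambda>x. a < x) st)"
  using assms
proof (induction xs st rule: stack_run.induct)
  case (2 x xs)
  show ?case
  proof (cases "x = a")
    case True
    then show ?thesis by (simp add: greater_before_stack_run_stacked)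
  next
    case False
    with 2 show ?thesis by auto
  qed
next
  case (3 x xs t st)
  have "t \<noteq> a" using "3.prems" by simp
  consider (push_a) "x = a" "x < t" | (push_other) "x \<noteq> a" "x < t"
    | (pop_greater) "t \<le> x" "a < t" | (pop_smaller) "t \<le> x" "t < a"
    using \<open>t \<noteq> a\<close> by fastforce
  then show ?case
  proof cases
    case push_a
    then show ?thesis by (simp add: greater_before_stack_run_stacked)
  next
    case push_other
    then have "greater_before a (stack_run xs (x # t # st)) =
        popped_run (greater_before a xs) (filter (\<lambda>x. a < x) (x # t # st))"
      using "3.prems" by (intro "3.IH"(1)) auto
    with push_other show ?thesis by auto
  next
    case pop_greater
    with 3 show ?thesis by auto
  next
    case pop_smaller
    with 3 show ?thesis by auto
  qed
qed auto

lemma greater_before_stack_sort: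
  "a \<in> set xs \<Longrightarrow> greater_before a (stack_sort xs) = popped (greater_before a xs)"
  by (simp add: stack_sort_def popped_def greater_before_stack_run)

lemma greater_before_stack_sort_funpow:
  assumes "a \<in> set xs"
  shows "greater_before a ((stack_sort ^^ k) xs) = (popped ^^ k) (greater_before a xs)"
  using assms by (induction k) (simp_all add: greater_before_stack_sort set_stack_sort_funpow)

lemma sorted_stack_sort_funpow_iff:
  assumes "distinct xs"
  shows "sorted_wrt (<) ((stack_sort ^^ k) xs) \<longleftrightarrow>
           (\<forall>a\<in>set xs. (popped ^^ k) (greater_before a xs) = [])"
  using assms
  by (simp add: sorted_wrt_less_iff_greater_before distinct_stack_sort_funpow
      set_stack_sort_funpow greater_before_stack_sort_funpow)

lemma Least_le_iff_upward_closed: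
  fixes P :: "'a::wellorder \<Rightarrow> bool"
  assumes "P n" and "\<And>i j. P i \<Longrightarrow> i \<le> j \<Longrightarrow> P j"
  shows "(LEAST k. P k) \<le> k \<longleftrightarrow> P k"
  using LeastI[of P, OF assms(1)] Least_le[of P k] assms(2) by blast

lemma sc_le_iff:
  assumes "distinct xs"
  shows "sc xs \<le> k \<longleftrightarrow> (\<forall>a\<in>set xs. (popped ^^ k) (greater_before a xs) = [])"
  unfolding sc_def sorted_stack_sort_funpow_iff[OF assms]
proof (rule Least_le_iff_upward_closed)
  show "\<forall>a\<in>set xs. (popped ^^ length xs) (greater_before a xs) = []"
    by (simp add: popped_funpow_eq_Nil length_greater_before_le)
qed (blast intro: popped_funpow_eq_Nil_mono)

lemma greater_before_prefix_ge:
  assumes "a \<in> set (prefix_ge xs i)"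
  shows "greater_before a (prefix_ge xs i) = greater_before a xs"
proof -
  have a: "xs ! (i - 1) \<le> a" "a \<in> set (take i xs)"
    using assms by (auto simp: prefix_ge_def)
  have "greater_before a (prefix_ge xs i) = greater_before a (take i xs)"
    unfolding prefix_ge_def using a(1) by (intro greater_before_filter) simp
  also have "\<dots> = greater_before a xs"
    using greater_before_append1[OF a(2), of "drop i xs"] by simp
  finally show ?thesis .
qed

lemma nth_mem_prefix_ge:
  assumes "j < length xs"
  shows "xs ! j \<in> set (prefix_ge xs (Suc j))"
  using assms by (simp add: prefix_ge_def take_Suc_conv_app_nth)

lemma UN_set_prefix_ge: "(\<Union>i\<in>{1..length xs}. set (prefix_ge xs i)) = set xs"
proof
  show "(\<Union>i\<in>{1..length xs}. set (prefix_ge xs i)) \<subseteq> set xs"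
    by (auto simp: prefix_ge_def dest: in_set_takeD)
  show "set xs \<subseteq> (\<Union>i\<in>{1..length xs}. set (prefix_ge xs i))"
  proof
    fix a assume "a \<in> set xs"
    then obtain j where "j < length xs" "a = xs ! j"
      by (auto simp: in_set_conv_nth)
    then show "a \<in> (\<Union>i\<in>{1..length xs}. set (prefix_ge xs i))"
      using nth_mem_prefix_ge[of j xs] by (intro UN_I[of "Suc j"]) auto
  qed
qed

lemma sc_le_iff_prefix_ge:
  assumes "distinct xs"
  shows "sc xs \<le> k \<longleftrightarrow> (\<forall>i\<in>{1..length xs}. sc (prefix_ge xs i) \<le> k)"
proof -
  let ?vanishes = "\<lambda>a. (popped ^^ k) (greater_before a xs) = []"
  have "distinct (prefix_ge xs i)" for i
    using assms by (simp add: prefix_ge_def)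
  then have sc_prefix_le_iff:
    "sc (prefix_ge xs i) \<le> k \<longleftrightarrow> (\<forall>a\<in>set (prefix_ge xs i). ?vanishes a)" for i
    by (simp add: sc_le_iff greater_before_prefix_ge)
  have "sc xs \<le> k \<longleftrightarrow> (\<forall>a\<in>(\<Union>i\<in>{1..length xs}. set (prefix_ge xs i)). ?vanishes a)"
    unfolding UN_set_prefix_ge by (rule sc_le_iff[OF assms])
  also have "\<dots> \<longleftrightarrow> (\<forall>i\<in>{1..length xs}. sc (prefix_ge xs i) \<le> k)"
    unfolding sc_prefix_le_iff by blast
  finally show ?thesis .
qed

lemma sc_eq_Max_prefix_ge:
  assumes "distinct xs" and "xs \<noteq> []"
  shows "sc xs = Max ((\<lambda>i. sc (prefix_ge xs i)) ` {1..length xs})" (is "_ = Max ?S")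
proof -
  have "?S \<noteq> {}"
    using assms(2) by (simp add: Suc_le_eq)
  then have "Max ?S \<le> k \<longleftrightarrow> sc xs \<le> k" for k
    by (simp add: sc_le_iff_prefix_ge[OF assms(1)])
  then show ?thesis
    by (meson antisym order_refl)
qed

theorem theorem1p5:
  fixes n :: nat and \<pi> :: "int list"
  assumes "n \<ge> 1"
    and "\<pi> \<in> permutations_of_set {1..int n}"
  shows "sc \<pi> = Max ((\<lambda>i. sc (prefix_ge \<pi> i)) ` {1..n})"
proof -
  have "distinct \<pi>"
    using assms(2) by (rule permutations_of_setD)
  moreover have length_eq: "length \<pi> = n"
    using length_finite_permutations_of_set[OF assms(2)] by simp
  moreover have "\<pi> \<noteq> []"
    using assms(1) length_eq by auto
  ultimately show ?thesis
    using sc_eq_Max_prefix_ge by blast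
qed

end
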